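(* Let $X,Y$ be topological spaces. If $X$ dominates $Y$, then $\mathrm{cat}(Y)\le\mathrm{cat}(X)$. Equivalently, if $\mathrm{cat}(Y)>\mathrm{cat}(X)$, then $X$ does not dominate $Y$.
   Context: $X$ dominates $Y$ if there exist continuous maps $f:X\to Y$ and $g:Y\to X$ such that $f\circ g$ is homotopic to the identity $1_Y$. A continuous map is null-homotopic if it is (freely) homotopic to a constant map. The LS category $\mathrm{cat}(X)$ of a space $X$ is the least positive integer $k$ such that $X$ is a union of open subsets $U_1,\dots,U_k$ with each inclusion $U_j\hookrightarrow X$ null-homotopic, and $\infty$ if no such integer exists. *)

theory Defs
  imports "HOL-Analysis.Analysis"
begin

definition dominates :: "'a topology \<Rightarrow> 'b topology \<Rightarrow> bool" where
  "dominates X Y \<longleftrightarrow>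
     (\<exists>f g. continuous_map X Y f \<and> continuous_map Y X g \<and>
            homotopic_with (\<lambda>_. True) Y Y (f \<circ> g) id)"

text \<open>
  The homotopy is free, and \<^const>\<open>homotopic_with\<close> already entails that the map is
  continuous. If \<open>X\<close> is nonempty, the constant \<open>c\<close> is forced to be a point of \<open>Y\<close>; if \<open>X\<close> is
  empty, the empty map counts as constant (the convention of \<^const>\<open>contractible_space\<close>).
\<close>

definition null_homotopic :: "'a topology \<Rightarrow> 'b topology \<Rightarrow> ('a \<Rightarrow> 'b) \<Rightarrow> bool" where
  "null_homotopic X Y f \<longleftrightarrow> (\<exists>c. homotopic_with (\<lambda>_. True) X Y f (\<lambda>_. c))"

text \<open>
  On \<^typ>\<open>enat\<close>, the infimum of a nonempty set is its least element, and \<open>Inf {} = \<infinity>\<close>.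
\<close>

definition ls_cat :: "'a topology \<Rightarrow> enat" where
  "ls_cat X = Inf {enat k | k. k \<ge> 1 \<and>
     (\<exists>U :: nat \<Rightarrow> 'a set.
        (\<forall>j\<in>{1..k}. openin X (U j) \<and> null_homotopic (subtopology X (U j)) X id) \<and>
        topspace X = (\<Union>j\<in>{1..k}. U j))}"

end

theory Submission
  imports Defs
begin

text \<open>
  Pulling a categorical cover of \<open>X\<close> back along \<open>g\<close> yields one of \<open>Y\<close>: over the preimage \<open>V\<close>
  of \<open>U\<close>, the inclusion of \<open>V\<close> is homotopic to \<open>f \<circ> g\<close>, which factors through the
  null-homotopic inclusion of \<open>U\<close>.
\<close>

lemma null_homotopic_inclusion_preimage:
  assumes f: "continuous_map X Y f" and g: "continuous_map Y X g"
    and fg: "homotopic_with (\<lambda>_. True) Y Y (f \<circ> g) id"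
    and U: "null_homotopic (subtopology X U) X id"
  shows "null_homotopic (subtopology Y {y \<in> topspace Y. g y \<in> U}) Y id"
proof -
  let ?V = "subtopology Y {y \<in> topspace Y. g y \<in> U}"
  obtain c where c: "homotopic_with (\<lambda>_. True) (subtopology X U) X id (\<lambda>_. c)"
    using U unfolding null_homotopic_def by blast
  \<comment> \<open>The codomain has to be shrunk to \<open>U\<close>, because the contraction of
    \<open>U\<close> to \<open>c\<close> is defined only there.\<close>
  have "continuous_map ?V (subtopology X U) g"
    using g by (auto simp: continuous_map_in_subtopology continuous_map_from_subtopology)
  from homotopic_with_compose_continuous_map_right[OF c this]
  have "homotopic_with (\<lambda>_. True) ?V X (id \<circ> g) ((\<lambda>_. c) \<circ> g)"
    by simp
  from homotopic_with_compose_continuous_map_left[OF this f]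
  have "homotopic_with (\<lambda>_. True) ?V Y (f \<circ> g) (\<lambda>_. f c)"
    by (simp add: o_def)
  \<comment> \<open>Precomposing the domination homotopy with the inclusion of \<open>?V\<close>
    restricts it to \<open>?V\<close>; it then runs from \<open>f \<circ> g\<close> to
    \<open>id\<close>, hence the reversal.\<close>
  moreover have "homotopic_with (\<lambda>_. True) ?V Y id (f \<circ> g)"
    using homotopic_with_compose_continuous_map_right[OF fg, of ?V id]
    by (subst homotopic_with_sym) (simp add: continuous_map_from_subtopology)
  ultimately show ?thesis
    unfolding null_homotopic_def by (intro exI) (rule homotopic_with_trans)
qed

lemma dominates_imp_ls_cat_le:
  assumes "dominates X Y"
  shows "ls_cat Y \<le> ls_cat X"
proof -
  obtain f g where f: "continuous_map X Y f" and g: "continuous_map Y X g"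
    and fg: "homotopic_with (\<lambda>_. True) Y Y (f \<circ> g) id"
    using assms unfolding dominates_def by blast
  have "\<exists>V. (\<forall>j\<in>{1..k}. openin Y (V j) \<and> null_homotopic (subtopology Y (V j)) Y id) \<and>
            topspace Y = (\<Union>j\<in>{1..k}. V j)"
    if U: "\<forall>j\<in>{1..k}. openin X (U j) \<and> null_homotopic (subtopology X (U j)) X id"
      and cover: "topspace X = (\<Union>j\<in>{1..k}. U j)" for k :: nat and U
  proof (intro exI conjI ballI)
    let ?V = "\<lambda>j. {y \<in> topspace Y. g y \<in> U j}"
    show "openin Y (?V j)" if "j \<in> {1..k}" for j
      using U that by (simp add: openin_continuous_map_preimage[OF g])
    show "null_homotopic (subtopology Y (?V j)) Y id" if "j \<in> {1..k}" for j
      using U that by (simp add: null_homotopic_inclusion_preimage[OF f g fg])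
    \<comment> \<open>\<open>g\<close> sends each point of \<open>Y\<close> into
      \<open>topspace X\<close>, hence into some \<open>U j\<close>.\<close>
    show "topspace Y = (\<Union>j\<in>{1..k}. ?V j)"
      using continuous_map_image_subset_topspace[OF g] unfolding cover by auto
  qed
  \<comment> \<open>Pulling back keeps the number \<open>k\<close> of sets, so every
    \<open>k\<close> admissible for \<open>X\<close> is admissible for \<open>Y\<close>, and
    \<open>Inf\<close> is antitone. If no \<open>k\<close> is admissible for \<open>X\<close>, the
    bound is \<infinity>.\<close>
  then show ?thesis
    unfolding ls_cat_def
    by (intro Inf_superset_mono Collect_mono impI) metis
qed

theorem mainTheorem14:
  fixes X :: "'a topology" and Y :: "'b topology"
  shows "(dominates X Y \<longrightarrow> ls_cat Y \<le> ls_cat X) \<and>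
         (ls_cat Y > ls_cat X \<longrightarrow> \<not> dominates X Y)"
  using dominates_imp_ls_cat_le[of X Y] by auto

end
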